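(* Let $(L,[\cdot,\cdot,\cdot])$ be a Lie triple system, $(M,\theta)$ a representation of it, $\mathcal H$ a 3-cocycle of $L$ with coefficients in $(M,\theta)$, and $T:M\to L$ a generalized Reynolds operator. Define the bilinear map $\theta_T:M\times M\to \mathrm{End}(L)$ by $$\theta_T(u,v)x=[x,Tu,Tv]-T\big(D(x,Tu)v-\theta(x,Tv)u+\mathcal H(x,Tu,Tv)\big)\qquad (u,v\in M,\ x\in L).$$ Then $(L,\theta_T)$ is a representation of the Lie triple system $(M,[\cdot,\cdot,\cdot]_T)$, where $$[u,v,w]_T=\theta(Tv,Tw)u-\theta(Tu,Tw)v+D(Tu,Tv)w+\mathcal H(Tu,Tv,Tw).$$
   Context: All vector spaces are over a field $\mathbb K$ of characteristic $0$. A Lie triple system (L.t.s.) is a vector space $L$ with a trilinear bracket satisfying $[x,x,y]=0$, $[x,y,z]+[y,z,x]+[z,x,y]=0$ and $[x,y,[z,t,e]]=[[x,y,z],t,e]+[z,[x,y,t],e]+[z,t,[x,y,e]]$ for all elements. A representation of an L.t.s. $L$ on a vector space $M$ is a bilinear map $\theta:L\times L\to \mathrm{End}(M)$ such that, with $D(x,y):=\theta(y,x)-\theta(x,y)$, $\theta(z,t)\theta(x,y)-\theta(y,t)\theta(x,z)-\theta(x,[y,z,t])+D(y,z)\theta(x,t)=0$ and $\theta(z,t)D(x,y)-D(x,y)\theta(z,t)+\theta([x,y,z],t)+\theta(z,[x,y,t])=0$. A 3-cocycle is a trilinear map $\mathcal H:L\times L\times L\to M$ with $\mathcal H(x,x,y)=0$,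 $\mathcal H(x,y,z)+\mathcal H(y,z,x)+\mathcal H(z,x,y)=0$ and $\mathcal H(x_1,x_2,[y_1,y_2,y_3])+D(x_1,x_2)\mathcal H(y_1,y_2,y_3)-\mathcal H([x_1,x_2,y_1],y_2,y_3)-\mathcal H(y_1,[x_1,x_2,y_2],y_3)=\mathcal H(y_1,y_2,[x_1,x_2,y_3])+\theta(y_2,y_3)\mathcal H(x_1,x_2,y_1)-\theta(y_1,y_3)\mathcal H(x_1,x_2,y_2)+D(y_1,y_2)\mathcal H(x_1,x_2,y_3)$. A linear map $T:M\to L$ is a generalized Reynolds operator if for all $u,v,w\in M$ $[Tu,Tv,Tw]=T\big(D(Tu,Tv)w+\theta(Tv,Tw)u-\theta(Tu,Tw)v+\mathcal H(Tu,Tv,Tw)\big)$. For such $T$, the bracket $[\cdot,\cdot,\cdot]_T$ makes $M$ a Lie triple system. *)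

theory Defs
  imports Complex_Main
begin

definition trilinear ::
  "('k::field \<Rightarrow> 'a::ab_group_add \<Rightarrow> 'a) \<Rightarrow> ('k \<Rightarrow> 'b::ab_group_add \<Rightarrow> 'b) \<Rightarrow>
   ('k \<Rightarrow> 'c::ab_group_add \<Rightarrow> 'c) \<Rightarrow> ('k \<Rightarrow> 'd::ab_group_add \<Rightarrow> 'd) \<Rightarrow>
   ('a \<Rightarrow> 'b \<Rightarrow> 'c \<Rightarrow> 'd) \<Rightarrow> bool"
  where "trilinear s1 s2 s3 s4 f \<longleftrightarrow>
    (\<forall>y z. Vector_Spaces.linear s1 s4 (\<lambda>x. f x y z)) \<and>
    (\<forall>x z. Vector_Spaces.linear s2 s4 (\<lambda>y. f x y z)) \<and>
    (\<forall>x y. Vector_Spaces.linear s3 s4 (\<lambda>z. f x y z))"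

locale lie_triple_system = vector_space scale
  for scale :: "'k::field_char_0 \<Rightarrow> 'l::ab_group_add \<Rightarrow> 'l" +
  fixes br :: "'l \<Rightarrow> 'l \<Rightarrow> 'l \<Rightarrow> 'l"
  assumes br_trilinear: "trilinear scale scale scale scale br"
    and br_alternating: "br x x y = 0"
    and br_cyclic: "br x y z + br y z x + br z x y = 0"
    and br_derivation: "br x y (br z t e) = br (br x y z) t e + br z (br x y t) e + br z t (br x y e)"

definition rep_D :: "('l \<Rightarrow> 'l \<Rightarrow> 'm::ab_group_add \<Rightarrow> 'm) \<Rightarrow> 'l \<Rightarrow> 'l \<Rightarrow> 'm \<Rightarrow> 'm"
  where "rep_D \<theta> x y m = \<theta> y x m - \<theta> x y m"

text \<open>A bilinear map from L \<open>\<times>\<close> L to End(M) is represented by the corresponding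
  trilinear map from L \<open>\<times>\<close> L \<open>\<times>\<close> M to M; identities in End(M) are stated pointwise.\<close>

locale lts_representation =
  lie_triple_system scaleL br + M: vector_space scaleM
  for scaleL :: "'k::field_char_0 \<Rightarrow> 'l::ab_group_add \<Rightarrow> 'l"
    and br :: "'l \<Rightarrow> 'l \<Rightarrow> 'l \<Rightarrow> 'l"
    and scaleM :: "'k \<Rightarrow> 'm::ab_group_add \<Rightarrow> 'm" +
  fixes \<theta> :: "'l \<Rightarrow> 'l \<Rightarrow> 'm \<Rightarrow> 'm"
  assumes theta_trilinear: "trilinear scaleL scaleL scaleM scaleM \<theta>"
    and theta_theta: "\<theta> z t (\<theta> x y m) - \<theta> y t (\<theta> x z m) - \<theta> x (br y z t) m
      + rep_D \<theta> y z (\<theta> x t m) = 0"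
    and theta_D: "\<theta> z t (rep_D \<theta> x y m) - rep_D \<theta> x y (\<theta> z t m)
      + \<theta> (br x y z) t m + \<theta> z (br x y t) m = 0"

locale lts_3cocycle = lts_representation scaleL br scaleM \<theta>
  for scaleL :: "'k::field_char_0 \<Rightarrow> 'l::ab_group_add \<Rightarrow> 'l"
    and br :: "'l \<Rightarrow> 'l \<Rightarrow> 'l \<Rightarrow> 'l"
    and scaleM :: "'k \<Rightarrow> 'm::ab_group_add \<Rightarrow> 'm"
    and \<theta> :: "'l \<Rightarrow> 'l \<Rightarrow> 'm \<Rightarrow> 'm" +
  fixes H :: "'l \<Rightarrow> 'l \<Rightarrow> 'l \<Rightarrow> 'm"
  assumes H_trilinear: "trilinear scaleL scaleL scaleL scaleM H"
    and H_alternating: "H x x y = 0"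
    and H_cyclic: "H x y z + H y z x + H z x y = 0"
    and H_cocycle: "H x1 x2 (br y1 y2 y3) + rep_D \<theta> x1 x2 (H y1 y2 y3)
        - H (br x1 x2 y1) y2 y3 - H y1 (br x1 x2 y2) y3
      = H y1 y2 (br x1 x2 y3) + \<theta> y2 y3 (H x1 x2 y1) - \<theta> y1 y3 (H x1 x2 y2)
        + rep_D \<theta> y1 y2 (H x1 x2 y3)"

locale generalized_reynolds_operator = lts_3cocycle scaleL br scaleM \<theta> H
  for scaleL :: "'k::field_char_0 \<Rightarrow> 'l::ab_group_add \<Rightarrow> 'l"
    and br :: "'l \<Rightarrow> 'l \<Rightarrow> 'l \<Rightarrow> 'l"
    and scaleM :: "'k \<Rightarrow> 'm::ab_group_add \<Rightarrow> 'm"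
    and \<theta> :: "'l \<Rightarrow> 'l \<Rightarrow> 'm \<Rightarrow> 'm"
    and H :: "'l \<Rightarrow> 'l \<Rightarrow> 'l \<Rightarrow> 'm" +
  fixes T :: "'m \<Rightarrow> 'l"
  assumes T_linear: "Vector_Spaces.linear scaleM scaleL T"
    and T_reynolds: "br (T u) (T v) (T w) =
      T (rep_D \<theta> (T u) (T v) w + \<theta> (T v) (T w) u - \<theta> (T u) (T w) v + H (T u) (T v) (T w))"

definition bracket_T ::
  "('l \<Rightarrow> 'l \<Rightarrow> 'm::ab_group_add \<Rightarrow> 'm) \<Rightarrow> ('l \<Rightarrow> 'l \<Rightarrow> 'l \<Rightarrow> 'm) \<Rightarrow> ('m \<Rightarrow> 'l) \<Rightarrow>
   'm \<Rightarrow> 'm \<Rightarrow> 'm \<Rightarrow> 'm"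
  where "bracket_T \<theta> H T u v w =
    \<theta> (T v) (T w) u - \<theta> (T u) (T w) v + rep_D \<theta> (T u) (T v) w + H (T u) (T v) (T w)"

definition theta_T ::
  "('l::ab_group_add \<Rightarrow> 'l \<Rightarrow> 'l \<Rightarrow> 'l) \<Rightarrow> ('l \<Rightarrow> 'l \<Rightarrow> 'm::ab_group_add \<Rightarrow> 'm) \<Rightarrow>
   ('l \<Rightarrow> 'l \<Rightarrow> 'l \<Rightarrow> 'm) \<Rightarrow> ('m \<Rightarrow> 'l) \<Rightarrow> 'm \<Rightarrow> 'm \<Rightarrow> 'l \<Rightarrow> 'l"
  where "theta_T br \<theta> H T u v x =
    br x (T u) (T v) - T (rep_D \<theta> x (T u) v - \<theta> x (T v) u + H x (T u) (T v))"

end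

theory Submission
  imports Defs "HOL-Analysis.Product_Vector"
begin

text \<open>
  The two axioms of a representation are the derivation law of a Lie triple system \<open>E\<close> in
  which all entries but one, the first or the third, lie in a subsystem \<open>A\<close>: the maps
  \<open>\<theta> a b = (\<lambda>e. [e, a, b])\<close> make \<open>E\<close> a representation of \<open>A\<close>, and \<open>D a b\<close> is then
  \<open>\<lambda>e. [a, b, e]\<close>.  Since \<open>A\<close> is closed under the bracket it is a subrepresentation, so
  \<open>E / A\<close> is a representation of \<open>A\<close> as well.  This is lemma \<open>quotient_by_subsystem\<close>, where
  the inclusion of \<open>A\<close> and the projection to the quotient are given by a split exact sequence.

  A representation \<open>\<theta>\<close> on \<open>M\<close> and a 3-cocycle \<open>H\<close> combine into one Lie triple system
  \<open>E = L \<times> M\<close>, the twisted semidirect product (lemma \<open>twisted_product\<close>).  A linear map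
  \<open>T\<close> is a generalized Reynolds operator exactly if its graph \<open>{(T u, u)}\<close> is a subsystem of
  \<open>E\<close>.  The second component identifies the graph with \<open>M\<close> and its bracket with \<open>[u, v, w]\<^sub>T\<close>,
  while \<open>(x, u) \<mapsto> x - T u\<close> identifies the quotient with \<open>L\<close>.  Under these identifications
  the action \<open>(e, a, b) \<mapsto> [e, a, b]\<close> on the quotient becomes
  \<open>[x, T u, T v] - T (D(x, T u) v - \<theta>(x, T v) u + H(x, T u, T v))\<close>, which is \<open>\<theta>\<^sub>T u v x\<close>.
\<close>

section \<open>Trilinear maps\<close>

lemma trilinear_iff:
  "trilinear s1 s2 s3 s4 f \<longleftrightarrow>
    vector_space s1 \<and> vector_space s2 \<and> vector_space s3 \<and> vector_space s4 \<and>
    (\<forall>x x' y z. f (x + x') y z = f x y z + f x' y z) \<and>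
    (\<forall>x y y' z. f x (y + y') z = f x y z + f x y' z) \<and>
    (\<forall>x y z z'. f x y (z + z') = f x y z + f x y z') \<and>
    (\<forall>c x y z. f (s1 c x) y z = s4 c (f x y z)) \<and>
    (\<forall>c x y z. f x (s2 c y) z = s4 c (f x y z)) \<and>
    (\<forall>c x y z. f x y (s3 c z) = s4 c (f x y z))"
  unfolding trilinear_def Vector_Spaces.linear_iff by auto

lemma trilinear_diff:
  assumes "trilinear s1 s2 s3 s4 f"
  shows "f (x - x') y z = f x y z - f x' y z"
    and "f x (y - y') z = f x y z - f x y' z"
    and "f x y (z - z') = f x y z - f x y z'"
  using assms unfolding trilinear_iff by (metis add_diff_cancel diff_add_cancel)+

lemma trilinear_0:
  assumes "trilinear s1 s2 s3 s4 f"
  shows "f 0 y z = 0" and "f x 0 z = 0" and "f x y 0 = 0"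
  using trilinear_diff[OF assms] by (metis diff_self)+

lemma trilinear_compose:
  assumes f: "trilinear s1 s2 s3 s4 f"
    and "Vector_Spaces.linear r1 s1 g1" "Vector_Spaces.linear r2 s2 g2"
      "Vector_Spaces.linear r3 s3 g3" "Vector_Spaces.linear s4 r4 h"
  shows "trilinear r1 r2 r3 r4 (\<lambda>x y z. h (f (g1 x) (g2 y) (g3 z)))"
  using assms unfolding trilinear_iff Vector_Spaces.linear_iff by simp

lemma trilinear_rotate:
  "trilinear s1 s2 s3 s4 f \<Longrightarrow> trilinear s2 s3 s1 s4 (\<lambda>y z x. f x y z)"
  unfolding trilinear_iff by auto

section \<open>The quotient of a Lie triple system by a subsystem\<close>

context lie_triple_system
begin

lemma br_skew: "br x y z = - br y x z"
proof -
  have "br (x + y) (x + y) z = br x x z + br x y z + (br y x z + br y y z)"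
    using br_trilinear unfolding trilinear_iff by (simp add: algebra_simps)
  then show ?thesis by (simp add: br_alternating eq_neg_iff_add_eq_0)
qed

lemma br_right_diff: "br z y x - br z x y = br x y z"
proof -
  have "br x y z + br y z x + br z x y = 0"
    by (rule br_cyclic)
  moreover have "br y z x = - br z y x"
    by (rule br_skew)
  ultimately show ?thesis by (simp add: algebra_simps)
qed

text \<open>
  The subsystem is the image of \<open>\<phi>\<close> and the quotient map is \<open>p\<close>; the maps \<open>q\<close> and \<open>s\<close> split the
  exact sequence \<open>0 \<rightarrow> A \<rightarrow> E \<rightarrow> V \<rightarrow> 0\<close>.  The action does not depend on \<open>s\<close>: replacing
  \<open>e\<close> by \<open>s (p e)\<close> changes it by an element of the subsystem, and brackets inside
  the subsystem are killed by \<open>p\<close>.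
\<close>

lemma quotient_by_subsystem:
  fixes scaleA :: "'k \<Rightarrow> 'a::ab_group_add \<Rightarrow> 'a" and scaleV :: "'k \<Rightarrow> 'v::ab_group_add \<Rightarrow> 'v"
  assumes \<phi>: "Vector_Spaces.linear scaleA scale \<phi>" and q: "Vector_Spaces.linear scale scaleA q"
    and p: "Vector_Spaces.linear scale scaleV p" and s: "Vector_Spaces.linear scaleV scale s"
    and q_\<phi>: "\<And>a. q (\<phi> a) = a" and p_s: "\<And>v. p (s v) = v"
    and exact: "\<And>e. p e = 0 \<longleftrightarrow> e \<in> range \<phi>"
    and closed: "\<And>a b c. br (\<phi> a) (\<phi> b) (\<phi> c) \<in> range \<phi>"
  shows "lts_representation scaleA (\<lambda>a b c. q (br (\<phi> a) (\<phi> b) (\<phi> c)))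
    scaleV (\<lambda>a b v. p (br (s v) (\<phi> a) (\<phi> b)))"
    (is "lts_representation _ ?brA _ ?\<theta>")
proof -
  have p_add: "p (x + y) = p x + p y" and p_diff: "p (x - y) = p x - p y" for x y
    using p unfolding Vector_Spaces.linear_iff by (auto, metis add_diff_cancel diff_add_cancel)
  have q_add: "q (x + y) = q x + q y" for x y
    using q unfolding Vector_Spaces.linear_iff by auto
  have q_0: "q 0 = 0"
    using q_add[of 0 0] by simp
  have \<phi>_brA: "\<phi> (?brA a b c) = br (\<phi> a) (\<phi> b) (\<phi> c)" for a b c
    using closed[of a b c] q_\<phi> by auto
  have p_closed: "p (br (\<phi> a) (\<phi> b) (\<phi> c)) = 0" for a b c
    using closed exact by blast
  have lift: "\<exists>a. s (p e) = e + \<phi> a" for e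
  proof -
    have "p (s (p e) - e) = 0" by (simp add: p_diff p_s)
    then obtain a where "s (p e) - e = \<phi> a" using exact by blast
    then show ?thesis by (metis add.commute diff_add_cancel)
  qed
  have add1: "br (x + x') y z = br x y z + br x' y z"
    and add3: "br x y (z + z') = br x y z + br x y z'" for x x' y z z'
    using br_trilinear unfolding trilinear_iff by auto
  have descend1: "p (br (s (p e)) (\<phi> a) (\<phi> b)) = p (br e (\<phi> a) (\<phi> b))" for e a b
    using lift[of e] by (auto simp: add1 p_add p_closed)
  have descend3: "p (br (\<phi> a) (\<phi> b) (s (p e))) = p (br (\<phi> a) (\<phi> b) e)" for e a b
    using lift[of e] by (auto simp: add3 p_add p_closed)
  have D: "rep_D ?\<theta> a b v = p (br (\<phi> a) (\<phi> b) (s v))" for a b v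
    by (simp add: rep_D_def br_right_diff flip: p_diff)
  show ?thesis
  proof (intro lts_representation.intro lie_triple_system.intro
      lie_triple_system_axioms.intro lts_representation_axioms.intro)
    show "vector_space scaleA" "vector_space scaleV"
      using \<phi> p unfolding Vector_Spaces.linear_iff by auto
    show "trilinear scaleA scaleA scaleA scaleA ?brA"
      by (rule trilinear_compose[OF br_trilinear \<phi> \<phi> \<phi> q])
    show "?brA a a b = 0" for a b
      by (simp add: br_alternating q_0)
    show "?brA a b c + ?brA b c a + ?brA c a b = 0" for a b c
      by (simp add: br_cyclic q_0 flip: q_add)
    show "?brA a b (?brA c d e) = ?brA (?brA a b c) d e + ?brA c (?brA a b d) e
      + ?brA c d (?brA a b e)" for a b c d e
      unfolding \<phi>_brA br_derivation[of "\<phi> a" "\<phi> b" "\<phi> c"] by (simp add: q_add)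
    show "trilinear scaleA scaleA scaleV scaleV ?\<theta>"
      by (rule trilinear_rotate[OF trilinear_compose[OF br_trilinear s \<phi> \<phi> p]])
    show "?\<theta> c d (?\<theta> a b v) - ?\<theta> b d (?\<theta> a c v) - ?\<theta> a (?brA b c d) v
      + rep_D ?\<theta> b c (?\<theta> a d v) = 0" for a b c d v
    proof -
      have "br (s v) (\<phi> a) (br (\<phi> b) (\<phi> c) (\<phi> d)) = br (br (s v) (\<phi> a) (\<phi> b)) (\<phi> c) (\<phi> d)
        - br (br (s v) (\<phi> a) (\<phi> c)) (\<phi> b) (\<phi> d) + br (\<phi> b) (\<phi> c) (br (s v) (\<phi> a) (\<phi> d))"
        using br_derivation[of "s v" "\<phi> a" "\<phi> b" "\<phi> c" "\<phi> d"]
          br_skew[of "\<phi> b" "br (s v) (\<phi> a) (\<phi> c)"] by simp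
      then show ?thesis
        unfolding D descend1 descend3 \<phi>_brA by (simp add: p_add p_diff)
    qed
    show "?\<theta> c d (rep_D ?\<theta> a b v) - rep_D ?\<theta> a b (?\<theta> c d v)
      + ?\<theta> (?brA a b c) d v + ?\<theta> c (?brA a b d) v = 0" for a b c d v
      unfolding D descend1 descend3 \<phi>_brA br_derivation[of "\<phi> a" "\<phi> b" "s v"]
      by (simp add: p_add)
  qed
qed

end

section \<open>The twisted semidirect product\<close>

definition twisted_bracket ::
  "('l \<Rightarrow> 'l \<Rightarrow> 'l \<Rightarrow> 'l) \<Rightarrow> ('l \<Rightarrow> 'l \<Rightarrow> 'm::ab_group_add \<Rightarrow> 'm) \<Rightarrow> ('l \<Rightarrow> 'l \<Rightarrow> 'l \<Rightarrow> 'm) \<Rightarrow>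
   'l \<times> 'm \<Rightarrow> 'l \<times> 'm \<Rightarrow> 'l \<times> 'm \<Rightarrow> 'l \<times> 'm"
  where "twisted_bracket br \<theta> H a b c =
    (br (fst a) (fst b) (fst c),
     \<theta> (fst b) (fst c) (snd a) - \<theta> (fst a) (fst c) (snd b) + rep_D \<theta> (fst a) (fst b) (snd c)
     + H (fst a) (fst b) (fst c))"

text \<open>
  The derivation law splits according to which entry carries the element of \<open>M\<close>.  If no entry
  does, it is the derivation law of \<open>L\<close> together with the cocycle identity.  If one of the
  last three entries does, it says that \<open>D x y\<close> acts as a derivation on \<open>\<theta>\<close>, hence also on \<open>D\<close>.
  If one of the first two does, it is the other axiom of a representation.
\<close>

lemma (in lts_3cocycle) twisted_product:
  "lie_triple_system (module_prod.scale scaleL scaleM) (twisted_bracket br \<theta> H)"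
proof -
  interpret P: vector_space_prod scaleL scaleM
    by unfold_locales
  note tri_br = br_trilinear[unfolded trilinear_iff]
  note tri_\<theta> = theta_trilinear[unfolded trilinear_iff]
  note tri_H = H_trilinear[unfolded trilinear_iff]
  have \<theta>_add: "\<theta> x y (m + n) = \<theta> x y m + \<theta> x y n" for x y m n
    using tri_\<theta> by blast
  note \<theta>_diff = trilinear_diff(3)[OF theta_trilinear]
  have D_add: "rep_D \<theta> x y (m + n) = rep_D \<theta> x y m + rep_D \<theta> x y n"
    and D_diff: "rep_D \<theta> x y (m - n) = rep_D \<theta> x y m - rep_D \<theta> x y n" for x y m n
    by (simp_all add: rep_D_def \<theta>_add \<theta>_diff)
  have D_\<theta>: "rep_D \<theta> x y (\<theta> z t m) =
      \<theta> z t (rep_D \<theta> x y m) + \<theta> (br x y z) t m + \<theta> z (br x y t) m" for x y z t m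
    using theta_D[of z t x y m] by (simp add: algebra_simps)
  have D_D: "rep_D \<theta> x y (rep_D \<theta> z t m) =
      rep_D \<theta> z t (rep_D \<theta> x y m) + rep_D \<theta> (br x y z) t m + rep_D \<theta> z (br x y t) m"
    for x y z t m
    unfolding rep_D_def[of \<theta> z] rep_D_def[of \<theta> "br x y z"] D_diff D_\<theta> by simp
  have \<theta>_br: "\<theta> x (br y z t) m =
      \<theta> z t (\<theta> x y m) - \<theta> y t (\<theta> x z m) + rep_D \<theta> y z (\<theta> x t m)" for x y z t m
    using theta_theta[of z t x y m] by (simp add: algebra_simps)
  have H_br: "H x1 x2 (br y1 y2 y3) =
      H (br x1 x2 y1) y2 y3 + H y1 (br x1 x2 y2) y3 + H y1 y2 (br x1 x2 y3)
      + \<theta> y2 y3 (H x1 x2 y1) - \<theta> y1 y3 (H x1 x2 y2) + rep_D \<theta> y1 y2 (H x1 x2 y3)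
      - rep_D \<theta> x1 x2 (H y1 y2 y3)" for x1 x2 y1 y2 y3
    using H_cocycle[of x1 x2 y1 y2 y3] by (simp add: algebra_simps)
  show ?thesis
  proof (intro lie_triple_system.intro lie_triple_system_axioms.intro)
    show "vector_space P.scale"
      by (rule P.p.vector_space_axioms)
    show "trilinear P.scale P.scale P.scale P.scale (twisted_bracket br \<theta> H)"
      unfolding trilinear_iff
      using tri_br tri_\<theta> tri_H P.p.vector_space_axioms
      by (simp add: twisted_bracket_def rep_D_def P.scale_def M.scale_right_distrib
          M.scale_right_diff_distrib)
    show "twisted_bracket br \<theta> H a a b = 0" for a b
      by (simp add: twisted_bracket_def br_alternating H_alternating rep_D_def zero_prod_def)
    show "twisted_bracket br \<theta> H a b c + twisted_bracket br \<theta> H b c a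
        + twisted_bracket br \<theta> H c a b = 0" for a b c
      using br_cyclic[of "fst a" "fst b" "fst c"] H_cyclic[of "fst a" "fst b" "fst c"]
      by (simp add: twisted_bracket_def rep_D_def zero_prod_def algebra_simps)
    show "twisted_bracket br \<theta> H a b (twisted_bracket br \<theta> H c d e) =
        twisted_bracket br \<theta> H (twisted_bracket br \<theta> H a b c) d e
        + twisted_bracket br \<theta> H c (twisted_bracket br \<theta> H a b d) e
        + twisted_bracket br \<theta> H c d (twisted_bracket br \<theta> H a b e)" for a b c d e
      unfolding twisted_bracket_def fst_conv snd_conv add_Pair prod.inject
    proof
      show "br (fst a) (fst b) (br (fst c) (fst d) (fst e)) =
          br (br (fst a) (fst b) (fst c)) (fst d) (fst e)
          + br (fst c) (br (fst a) (fst b) (fst d)) (fst e)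
          + br (fst c) (fst d) (br (fst a) (fst b) (fst e))"
        by (rule br_derivation)
    \<comment> \<open>\<open>D_D\<close> and \<open>D_\<theta>\<close> are oriented to move \<open>D a b\<close> inwards; uninstantiated they would move
      the operators past each other forever.\<close>
    qed (simp add: \<theta>_add \<theta>_diff D_add D_diff
      D_\<theta>[of "fst a" "fst b"] D_D[of "fst a" "fst b"] \<theta>_br[of _ "fst c" "fst d" "fst e"]
      H_br[of "fst a" "fst b"] algebra_simps)
  qed
qed

section \<open>The graph of a generalized Reynolds operator\<close>

theorem proposition4p7:
  fixes scaleL :: "'k::field_char_0 \<Rightarrow> 'l::ab_group_add \<Rightarrow> 'l"
    and scaleM :: "'k \<Rightarrow> 'm::ab_group_add \<Rightarrow> 'm"
    and br :: "'l \<Rightarrow> 'l \<Rightarrow> 'l \<Rightarrow> 'l"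
    and \<theta> :: "'l \<Rightarrow> 'l \<Rightarrow> 'm \<Rightarrow> 'm"
    and H :: "'l \<Rightarrow> 'l \<Rightarrow> 'l \<Rightarrow> 'm"
    and T :: "'m \<Rightarrow> 'l"
  assumes "lie_triple_system scaleL br"
    and "lts_representation scaleL br scaleM \<theta>"
    and "lts_3cocycle scaleL br scaleM \<theta> H"
    and "generalized_reynolds_operator scaleL br scaleM \<theta> H T"
  shows "lts_representation scaleM (bracket_T \<theta> H T) scaleL (theta_T br \<theta> H T)"
proof -
  interpret generalized_reynolds_operator scaleL br scaleM \<theta> H T
    by (rule assms)
  interpret P: vector_space_prod scaleL scaleM
    by unfold_locales
  interpret E: lie_triple_system P.scale "twisted_bracket br \<theta> H"
    by (rule twisted_product)
  interpret T: Vector_Spaces.linear scaleM scaleL T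
    by (rule T_linear)
  let ?\<phi> = "\<lambda>u. (T u, u)"
  let ?p = "\<lambda>e. fst e - T (snd e)"
  let ?s = "\<lambda>x. (x, 0 :: 'm)"
  have bracket: "bracket_T \<theta> H T = (\<lambda>u v w. snd (twisted_bracket br \<theta> H (?\<phi> u) (?\<phi> v) (?\<phi> w)))"
    by (simp add: fun_eq_iff bracket_T_def twisted_bracket_def)
  have action: "theta_T br \<theta> H T = (\<lambda>u v x. ?p (twisted_bracket br \<theta> H (?s x) (?\<phi> u) (?\<phi> v)))"
    by (simp add: fun_eq_iff theta_T_def twisted_bracket_def trilinear_0[OF theta_trilinear]
        algebra_simps)
  show ?thesis
    unfolding bracket action
  proof (rule E.quotient_by_subsystem)
    show "Vector_Spaces.linear scaleM P.scale ?\<phi>"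
      using P.p.vector_space_axioms M.vector_space_axioms
      by (simp add: Vector_Spaces.linear_iff P.scale_def T.add T.scale)
    show "Vector_Spaces.linear P.scale scaleM snd"
      by (rule P.linear_snd)
    show "Vector_Spaces.linear P.scale scaleL ?p"
      using P.p.vector_space_axioms vector_space_axioms
      by (simp add: Vector_Spaces.linear_iff P.scale_def T.add T.scale scale_right_diff_distrib)
    show "Vector_Spaces.linear scaleL P.scale ?s"
      using P.p.vector_space_axioms vector_space_axioms
      by (simp add: Vector_Spaces.linear_iff P.scale_def)
    show "?p e = 0 \<longleftrightarrow> e \<in> range ?\<phi>" for e
      by (cases e) auto
    show "twisted_bracket br \<theta> H (?\<phi> u) (?\<phi> v) (?\<phi> w) \<in> range ?\<phi>" for u v w
      using T_reynolds[of u v w] by (auto simp: twisted_bracket_def image_iff algebra_simps)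
  qed (simp_all add: T.zero)
qed

end
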